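(* Let $\Sigma$ be a simplicial fan in $\mathbb{R}^d$ with ray matrix $U$. If $\Sigma=\overline{\Sigma}$ and $\{y\in Y_\Sigma:M\cdot y=0\}=\emptyset$, then ${\rm Sing}(\mathcal{A}_\Sigma)\subseteq Z(\Sigma)$.
   Context: A simplicial fan $\Sigma$ is a (finite) polyhedral fan whose cones are generated by linearly independent vectors. $\Sigma(k)$ is the set of $k$-dimensional cones, $\sigma(1)$ the set of rays of $\sigma$, $n=|\Sigma(1)|$. A ray matrix $U\in\mathbb{R}^{n\times d}$, assumed of rank $d$, has rows $u_\rho$, $\rho\in\Sigma(1)$, with $u_\rho$ a nonzero generator of $\rho$; $U_\sigma$ is the submatrix with rows indexed by $\sigma(1)$. ${\rm Adj}_\Sigma(x)=\sum_{\sigma\in\Sigma(d)}|\det U_\sigma|\prod_{\rho\notin\sigma(1)}x_\rho$. $\mathbb{P}^{n-1}$ is complex projective space with homogeneous coordinates $x_\rho$; $\mathcal{A}_\Sigma=\{x\in\mathbb{P}^{n-1}:{\rm Adj}_\Sigma(x)=0\}$ and ${\rm Sing}(\mathcal{A}_\Sigma)=\{x\in\mathbb{P}^{n-1}:\partial{\rm Adj}_\Sigma/\partial x_\rho(x)=0\text{ for all }\rho\in\Sigma(1)\}$. $\overline{\Sigma}\subseteq\Sigma$ is the subfan consisting of all $d$-dimensional cones of $\Sigma$ and their faces. For $\sigma\in\Sigma$ let $x^{\hat\sigma}=\prod_{\rho\notin\sigma(1)}x_\rho$; the irrelevant ideal is $B(\Sigma)=\langle x^{\hat\sigma}:\sigma\in\Sigma\rangle\subseteq\mathbb{C}[x_\rho:\rho\in\Sigma(1)]$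 and $Z(\Sigma)=V(B(\Sigma))\subset\mathbb{P}^{n-1}$ is its zero locus. When $\Sigma=\overline\Sigma$, let $\phi_\Sigma:\mathbb{P}^{n-1}\setminus Z(\Sigma)\to\mathbb{P}^{|\Sigma(d)|-1}$, $\phi_\Sigma(x)=(x^{\hat\sigma})_{\sigma\in\Sigma(d)}$, and let $Y_\Sigma\subseteq\mathbb{P}^{|\Sigma(d)|-1}$ be the closure of its image. $M$ is the $|\Sigma(1)|\times|\Sigma(d)|$ matrix, with rows indexed by rays and columns by $d$-dimensional cones, with entries $M_{\rho,\sigma}=|\det U_\sigma|$ if $\rho\notin\sigma(1)$ and $M_{\rho,\sigma}=0$ otherwise. The homogeneous coordinates of $y=(y_\sigma)_{\sigma\in\Sigma(d)}$ are viewed as a column vector in $M\cdot y$. *)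

theory Defs
  imports "HOL-Analysis.Analysis" "HOL-Library.Poly_Mapping"
begin

section \<open>Simplicial fans\<close>

text \<open>Isabelle's \<open>face_of\<close> also counts the empty set as a face; the convex-geometric
  convention for cones excludes it.\<close>

definition polyhedral_fan :: "'a::euclidean_space set set \<Rightarrow> bool" where
  "polyhedral_fan \<Sigma> \<longleftrightarrow>
     finite \<Sigma> \<and>
     (\<forall>\<sigma>\<in>\<Sigma>. polyhedron \<sigma> \<and> convex_cone \<sigma>) \<and>
     (\<forall>\<sigma>\<in>\<Sigma>. \<forall>\<tau>. \<tau> face_of \<sigma> \<and> \<tau> \<noteq> {} \<longrightarrow> \<tau> \<in> \<Sigma>) \<and>
     (\<forall>\<sigma>\<in>\<Sigma>. \<forall>\<tau>\<in>\<Sigma>. (\<sigma> \<inter> \<tau>) face_of \<sigma> \<and> (\<sigma> \<inter> \<tau>) face_of \<tau>)"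

definition simplicial_cone :: "'a::euclidean_space set \<Rightarrow> bool" where
  "simplicial_cone \<sigma> \<longleftrightarrow> (\<exists>B. finite B \<and> independent B \<and> \<sigma> = convex_cone hull B)"

definition simplicial_fan :: "'a::euclidean_space set set \<Rightarrow> bool" where
  "simplicial_fan \<Sigma> \<longleftrightarrow> polyhedral_fan \<Sigma> \<and> (\<forall>\<sigma>\<in>\<Sigma>. simplicial_cone \<sigma>)"

text \<open>\<open>fan_cones \<Sigma> k\<close> is \<open>\<Sigma>(k)\<close> and \<open>cone_rays \<sigma>\<close> is \<open>\<sigma>(1)\<close>; the dimension of a cone is that of
  its linear span.\<close>

definition fan_cones :: "'a::euclidean_space set set \<Rightarrow> nat \<Rightarrow> 'a set set" where
  "fan_cones \<Sigma> k = {\<sigma>\<in>\<Sigma>. dim \<sigma> = k}"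

definition cone_rays :: "'a::euclidean_space set \<Rightarrow> 'a set set" where
  "cone_rays \<sigma> = {\<rho>. \<rho> face_of \<sigma> \<and> dim \<rho> = 1}"

definition pure_subfan :: "'a::euclidean_space set set \<Rightarrow> 'a set set" where
  "pure_subfan \<Sigma> = {\<tau>. \<tau> \<noteq> {} \<and> (\<exists>\<sigma>\<in>fan_cones \<Sigma> (DIM('a)). \<tau> face_of \<sigma>)}"

text \<open>The rows of a ray matrix are indexed by the rays themselves, so it is a function on \<open>\<Sigma>(1)\<close>.
  The last conjunct says that its (row) rank is \<open>d\<close>.\<close>

definition ray_matrix :: "(real^'d) set set \<Rightarrow> ((real^'d) set \<Rightarrow> real^'d) \<Rightarrow> bool" where
  "ray_matrix \<Sigma> u \<longleftrightarrow>
     (\<forall>\<rho>\<in>fan_cones \<Sigma> 1. u \<rho> \<noteq> 0 \<and> \<rho> = convex_cone hull {u \<rho>}) \<and>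
     dim (u ` fan_cones \<Sigma> 1) = CARD('d)"

text \<open>\<open>\<bar>det U\<^sub>\<sigma>\<bar>\<close> for a \<open>d\<close>-dimensional simplicial cone. Its \<open>d\<close> rays have to be enumerated by the index
  type \<open>'d\<close> to form a square matrix; the absolute value does not depend on the enumeration.\<close>

definition abs_det_cone :: "((real^'d) set \<Rightarrow> real^'d) \<Rightarrow> (real^'d) set \<Rightarrow> real" where
  "abs_det_cone u \<sigma> =
     (let f = (SOME f. bij_betw f (UNIV :: 'd set) (cone_rays \<sigma>)) in \<bar>det (\<chi> i. u (f i))\<bar>)"

lemma abs_det_cone_eq:
  fixes u :: "(real^'d) set \<Rightarrow> real^'d"
  assumes g: "bij_betw g (UNIV :: 'd set) (cone_rays \<sigma>)"
  shows "abs_det_cone u \<sigma> = \<bar>det (\<chi> i. u (g i))\<bar>"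
proof -
  define f where "f = (SOME f. bij_betw f (UNIV :: 'd set) (cone_rays \<sigma>))"
  have f: "bij_betw f UNIV (cone_rays \<sigma>)"
    unfolding f_def using someI[of "\<lambda>f. bij_betw f UNIV (cone_rays \<sigma>)", OF g] .
  define p where "p = inv_into UNIV g \<circ> f"
  have "bij p"
    unfolding p_def by (rule bij_betw_trans[OF f bij_betw_inv_into[OF g]])
  then have p: "p permutes UNIV"
    by (rule bij_imp_permutes) simp
  have gp: "g (p i) = f i" for i
  proof -
    have "f i \<in> g ` UNIV"
      using bij_betwE[OF f] bij_betw_imp_surj_on[OF g] by blast
    then show ?thesis
      unfolding p_def comp_def by (rule f_inv_into_f)
  qed
  have "det (\<chi> i. u (f i)) = of_int (sign p) * det (\<chi> i. u (g i))"
    using det_permute_rows[OF p, of "\<chi> i. u (g i)"] by (simp add: gp)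
  then have "\<bar>det (\<chi> i. u (f i))\<bar> = \<bar>det (\<chi> i. u (g i))\<bar>"
    by (simp add: abs_mult sign_def)
  then show ?thesis
    by (simp add: abs_det_cone_def f_def Let_def)
qed


section \<open>Complex projective space with coordinates indexed by a set\<close>

text \<open>Coordinate vectors indexed by \<open>I\<close> are functions on the whole type that vanish outside \<open>I\<close>, and
  a projective point is a class of nonzero vectors modulo scaling.\<close>

definition nonzero_vecs :: "'i set \<Rightarrow> ('i \<Rightarrow> complex) set" where
  "nonzero_vecs I = {x. (\<forall>i. i \<notin> I \<longrightarrow> x i = 0) \<and> (\<exists>i. x i \<noteq> 0)}"

definition proj_rel :: "'i set \<Rightarrow> (('i \<Rightarrow> complex) \<times> ('i \<Rightarrow> complex)) set" where
  "proj_rel I = {(x, y). x \<in> nonzero_vecs I \<and> (\<exists>c. c \<noteq> 0 \<and> y = (\<lambda>i. c * x i))}"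

definition proj_space :: "'i set \<Rightarrow> ('i \<Rightarrow> complex) set set" where
  "proj_space I = nonzero_vecs I // proj_rel I"

definition proj_point :: "'i set \<Rightarrow> ('i \<Rightarrow> complex) \<Rightarrow> ('i \<Rightarrow> complex) set" where
  "proj_point I x = proj_rel I `` {x}"

lemma equiv_proj_rel: "equiv (nonzero_vecs I) (proj_rel I)"
proof (rule equivI)
  show "proj_rel I \<subseteq> nonzero_vecs I \<times> nonzero_vecs I"
    by (auto simp: proj_rel_def nonzero_vecs_def)
  show "refl_on (nonzero_vecs I) (proj_rel I)"
    by (auto simp: refl_on_def proj_rel_def intro!: exI[of _ 1])
  show "sym (proj_rel I)"
  proof (rule symI)
    fix x y assume "(x, y) \<in> proj_rel I"
    then obtain c where c: "x \<in> nonzero_vecs I" "c \<noteq> 0" "y = (\<lambda>i. c * x i)"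
      by (auto simp: proj_rel_def)
    have "y \<in> nonzero_vecs I"
      using c by (simp add: nonzero_vecs_def)
    moreover have "x = (\<lambda>i. inverse c * y i)"
      using c by (simp add: mult.assoc[symmetric])
    moreover have "inverse c \<noteq> 0"
      using c by simp
    ultimately show "(y, x) \<in> proj_rel I"
      unfolding proj_rel_def by blast
  qed
  show "trans (proj_rel I)"
  proof (rule transI)
    fix x y z assume "(x, y) \<in> proj_rel I" "(y, z) \<in> proj_rel I"
    then obtain c e where x: "x \<in> nonzero_vecs I" and c: "c \<noteq> 0" "y = (\<lambda>i. c * x i)"
      and e: "e \<noteq> 0" "z = (\<lambda>i. e * y i)"
      by (auto simp: proj_rel_def)
    have "e * c \<noteq> 0" "z = (\<lambda>i. (e * c) * x i)"
      using c e by (simp_all add: mult.assoc)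
    with x show "(x, z) \<in> proj_rel I"
      unfolding proj_rel_def by blast
  qed
qed


section \<open>Polynomials, projective zero loci and Zariski closure\<close>

text \<open>Multivariate polynomials over \<open>\<complex>\<close>: finitely supported maps from exponent vectors to
  coefficients, with the convolution product of \<open>Poly_Mapping\<close>.\<close>

type_synonym 'i cpoly = "('i \<Rightarrow>\<^sub>0 nat) \<Rightarrow>\<^sub>0 complex"

definition pvar :: "'i \<Rightarrow> 'i cpoly" where
  "pvar i = Poly_Mapping.single (Poly_Mapping.single i 1) 1"

definition pconst :: "complex \<Rightarrow> 'i cpoly" where
  "pconst c = Poly_Mapping.single 0 c"

definition poly_ring :: "'i set \<Rightarrow> 'i cpoly set" where
  "poly_ring I = {p. \<forall>m\<in>Poly_Mapping.keys p. Poly_Mapping.keys m \<subseteq> I}"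

definition peval :: "'i cpoly \<Rightarrow> ('i \<Rightarrow> complex) \<Rightarrow> complex" where
  "peval p x =
     (\<Sum>m\<in>Poly_Mapping.keys p. Poly_Mapping.lookup p m *
        (\<Prod>i\<in>Poly_Mapping.keys m. x i ^ Poly_Mapping.lookup m i))"

definition homogeneous :: "'i cpoly \<Rightarrow> bool" where
  "homogeneous p \<longleftrightarrow>
     (\<exists>k. \<forall>m\<in>Poly_Mapping.keys p. (\<Sum>i\<in>Poly_Mapping.keys m. Poly_Mapping.lookup m i) = k)"

definition poly_ideal :: "'i set \<Rightarrow> 'i cpoly set \<Rightarrow> bool" where
  "poly_ideal I J \<longleftrightarrow>
     J \<subseteq> poly_ring I \<and> 0 \<in> J \<and> (\<forall>p\<in>J. \<forall>q\<in>J. p + q \<in> J) \<and>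
     (\<forall>r\<in>poly_ring I. \<forall>p\<in>J. r * p \<in> J)"

definition proj_zeros :: "'i set \<Rightarrow> 'i cpoly set \<Rightarrow> ('i \<Rightarrow> complex) set set" where
  "proj_zeros I S = {X \<in> proj_space I. \<forall>x\<in>X. \<forall>p\<in>S. peval p x = 0}"

definition zariski_closed :: "'i set \<Rightarrow> ('i \<Rightarrow> complex) set set \<Rightarrow> bool" where
  "zariski_closed I A \<longleftrightarrow>
     (\<exists>S. S \<subseteq> {p \<in> poly_ring I. homogeneous p} \<and> A = proj_zeros I S)"


section \<open>The adjoint of a simplicial fan\<close>

text \<open>\<open>x_hat \<Sigma> \<sigma>\<close> is the product of the variables \<open>x\<^sub>\<rho>\<close> over the rays \<open>\<rho>\<close> of \<open>\<Sigma>\<close> not in \<open>\<sigma>(1)\<close>.\<close>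

definition x_hat :: "'a::euclidean_space set set \<Rightarrow> 'a set \<Rightarrow> 'a set cpoly" where
  "x_hat \<Sigma> \<sigma> = (\<Prod>\<rho>\<in>fan_cones \<Sigma> 1 - cone_rays \<sigma>. pvar \<rho>)"

definition Adj :: "(real^'d) set set \<Rightarrow> ((real^'d) set \<Rightarrow> real^'d) \<Rightarrow> (real^'d) set cpoly" where
  "Adj \<Sigma> u =
     (\<Sum>\<sigma>\<in>fan_cones \<Sigma> CARD('d). pconst (complex_of_real (abs_det_cone u \<sigma>)) * x_hat \<Sigma> \<sigma>)"

text \<open>The singular locus: \<open>deriv\<close> is applied in the single coordinate \<open>\<rho>\<close>, so it is the partial
  derivative \<open>\<partial>Adj/\<partial>x\<^sub>\<rho>\<close> at \<open>x\<close>.\<close>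

definition Sing :: "(real^'d) set set \<Rightarrow> ((real^'d) set \<Rightarrow> real^'d)
    \<Rightarrow> ((real^'d) set \<Rightarrow> complex) set set" where
  "Sing \<Sigma> u =
     {X \<in> proj_space (fan_cones \<Sigma> 1). \<forall>x\<in>X. \<forall>\<rho>\<in>fan_cones \<Sigma> 1.
        deriv (\<lambda>t. peval (Adj \<Sigma> u) (x(\<rho> := t))) (x \<rho>) = 0}"

definition irrelevant_ideal :: "'a::euclidean_space set set \<Rightarrow> 'a set cpoly set" where
  "irrelevant_ideal \<Sigma> = poly_ideal (fan_cones \<Sigma> 1) hull (x_hat \<Sigma> ` \<Sigma>)"

definition irrelevant_locus :: "'a::euclidean_space set set \<Rightarrow> ('a set \<Rightarrow> complex) set set" where
  "irrelevant_locus \<Sigma> = proj_zeros (fan_cones \<Sigma> 1) (irrelevant_ideal \<Sigma>)"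

text \<open>The map \<open>\<phi>\<^sub>\<Sigma>\<close>. All representatives of a projective point \<open>X\<close> outside the irrelevant locus have
  the same image point, because the monomials indexed by \<open>d\<close>-dimensional cones all have the same
  degree and, for a fan equal to its pure subfan, do not all vanish on \<open>X\<close>; \<open>the_elem\<close> extracts
  this common image point.\<close>

definition phi_vec :: "'a::euclidean_space set set \<Rightarrow> ('a set \<Rightarrow> complex) \<Rightarrow> 'a set \<Rightarrow> complex" where
  "phi_vec \<Sigma> x = (\<lambda>\<sigma>. if \<sigma> \<in> fan_cones \<Sigma> (DIM('a)) then peval (x_hat \<Sigma> \<sigma>) x else 0)"

definition phi :: "'a::euclidean_space set set \<Rightarrow> ('a set \<Rightarrow> complex) set \<Rightarrow> ('a set \<Rightarrow> complex) set" where
  "phi \<Sigma> X = the_elem ((\<lambda>x. proj_point (fan_cones \<Sigma> (DIM('a))) (phi_vec \<Sigma> x)) ` X)"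

definition Y_variety :: "'a::euclidean_space set set \<Rightarrow> ('a set \<Rightarrow> complex) set set" where
  "Y_variety \<Sigma> =
     zariski_closed (fan_cones \<Sigma> (DIM('a))) hull
       (phi \<Sigma> ` (proj_space (fan_cones \<Sigma> 1) - irrelevant_locus \<Sigma>))"

definition M_matrix :: "((real^'d) set \<Rightarrow> real^'d) \<Rightarrow> (real^'d) set \<Rightarrow> (real^'d) set \<Rightarrow> real" where
  "M_matrix u \<rho> \<sigma> = (if \<rho> \<notin> cone_rays \<sigma> then abs_det_cone u \<sigma> else 0)"

text \<open>Points \<open>y\<close> of the projective space on the \<open>d\<close>-dimensional cones with \<open>M \<cdot> y = 0\<close>.\<close>

definition M_kernel :: "(real^'d) set set \<Rightarrow> ((real^'d) set \<Rightarrow> real^'d)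
    \<Rightarrow> ((real^'d) set \<Rightarrow> complex) set set" where
  "M_kernel \<Sigma> u =
     {Y \<in> proj_space (fan_cones \<Sigma> CARD('d)). \<forall>y\<in>Y. \<forall>\<rho>\<in>fan_cones \<Sigma> 1.
        (\<Sum>\<sigma>\<in>fan_cones \<Sigma> CARD('d). complex_of_real (M_matrix u \<rho> \<sigma>) * y \<sigma>) = 0}"

end

theory Submission
  imports Defs
begin

text \<open>Every monomial of the adjoint is square-free, so \<open>x\<^sub>\<rho> \<cdot> \<partial>Adj/\<partial>x\<^sub>\<rho>\<close> keeps exactly the monomials
  of the cones \<open>\<sigma>\<close> with \<open>\<rho> \<notin> \<sigma>(1)\<close>; it is the coordinate \<open>\<rho>\<close> of \<open>M \<cdot> \<phi>\<^sub>\<Sigma>(x)\<close>. A singular point outside the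
  irrelevant locus would therefore be mapped by \<open>\<phi>\<^sub>\<Sigma>\<close> to a point of \<open>Y\<^sub>\<Sigma>\<close> in the kernel of \<open>M\<close>.
  That \<open>\<phi>\<^sub>\<Sigma>\<close> is well defined on projective points rests on each \<open>d\<close>-dimensional simplicial cone having
  exactly \<open>d\<close> rays, which makes all the monomials have degree \<open>n - d\<close>.\<close>

section \<open>Evaluation at a point as a ring homomorphism\<close>

definition mon_eval :: "('i \<Rightarrow>\<^sub>0 nat) \<Rightarrow> ('i \<Rightarrow> complex) \<Rightarrow> complex" where
  "mon_eval m x = (\<Prod>i\<in>Poly_Mapping.keys m. x i ^ Poly_Mapping.lookup m i)"

text \<open>Exponents outside \<open>keys m\<close> are zero and contribute factors 1. This brings
  two monomials with different supports to a common index set.\<close>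

lemma mon_eval_superset:
  assumes "finite A" "Poly_Mapping.keys m \<subseteq> A"
  shows "mon_eval m x = (\<Prod>i\<in>A. x i ^ Poly_Mapping.lookup m i)"
  unfolding mon_eval_def
  by (rule prod.mono_neutral_left) (use assms in \<open>auto simp: in_keys_iff\<close>)

lemma mon_eval_add: "mon_eval (m + n) x = mon_eval m x * mon_eval n x"
proof -
  let ?A = "Poly_Mapping.keys m \<union> Poly_Mapping.keys n"
  have "mon_eval (m + n) x = (\<Prod>i\<in>?A. x i ^ Poly_Mapping.lookup (m + n) i)"
    by (rule mon_eval_superset) (use keys_add[of m n] in auto)
  also have "\<dots> = (\<Prod>i\<in>?A. x i ^ Poly_Mapping.lookup m i) * (\<Prod>i\<in>?A. x i ^ Poly_Mapping.lookup n i)"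
    by (simp add: lookup_add power_add prod.distrib)
  also have "\<dots> = mon_eval m x * mon_eval n x"
    by (simp add: mon_eval_superset[of ?A])
  finally show ?thesis .
qed

text \<open>The added terms have coefficient zero. A common summation range is needed because
  cancellation can make \<open>keys (p + q)\<close> smaller than the union of the two
  supports.\<close>

lemma peval_superset:
  assumes "finite A" "Poly_Mapping.keys p \<subseteq> A"
  shows "peval p x = (\<Sum>m\<in>A. Poly_Mapping.lookup p m * mon_eval m x)"
  unfolding peval_def mon_eval_def[symmetric]
  by (rule sum.mono_neutral_left) (use assms in \<open>auto simp: in_keys_iff\<close>)

lemma peval_zero [simp]: "peval 0 x = 0"
  by (simp add: peval_def)

lemma peval_add: "peval (p + q) x = peval p x + peval q x"
proof -
  let ?A = "Poly_Mapping.keys p \<union> Poly_Mapping.keys q"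
  have "peval (p + q) x = (\<Sum>m\<in>?A. Poly_Mapping.lookup (p + q) m * mon_eval m x)"
    by (rule peval_superset) (use keys_add[of p q] in auto)
  also have "\<dots> = (\<Sum>m\<in>?A. Poly_Mapping.lookup p m * mon_eval m x)
                + (\<Sum>m\<in>?A. Poly_Mapping.lookup q m * mon_eval m x)"
    by (simp add: lookup_add distrib_right sum.distrib)
  also have "\<dots> = peval p x + peval q x"
    by (simp add: peval_superset[of ?A])
  finally show ?thesis .
qed

lemma peval_sum: "peval (\<Sum>a\<in>A. f a) x = (\<Sum>a\<in>A. peval (f a) x)"
  by (induction A rule: infinite_finite_induct) (simp_all add: peval_add)

lemma peval_single: "peval (Poly_Mapping.single m c) x = c * mon_eval m x"
  by (subst peval_superset[of "{m}"]) auto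

text \<open>Expanding both factors into single terms reduces multiplicativity to that of monomials,
  \<open>mon_eval_add\<close>.\<close>

lemma peval_mult: "peval (p * q) x = peval p x * peval q x"
proof -
  have expand: "r = (\<Sum>m\<in>Poly_Mapping.keys r. Poly_Mapping.single m (Poly_Mapping.lookup r m))"
    for r :: "'a cpoly"
    by (rule poly_mapping_eqI) (auto simp: lookup_sum lookup_single when_def in_keys_iff)
  have "p * q = (\<Sum>m\<in>Poly_Mapping.keys p. \<Sum>n\<in>Poly_Mapping.keys q.
      Poly_Mapping.single (m + n) (Poly_Mapping.lookup p m * Poly_Mapping.lookup q n))"
    by (subst expand[of p], subst expand[of q]) (simp add: sum_product mult_single)
  then have "peval (p * q) x = (\<Sum>m\<in>Poly_Mapping.keys p. \<Sum>n\<in>Poly_Mapping.keys q.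
      (Poly_Mapping.lookup p m * mon_eval m x) * (Poly_Mapping.lookup q n * mon_eval n x))"
    by (simp add: peval_sum peval_single mon_eval_add mult_ac)
  also have "\<dots> = peval p x * peval q x"
    by (simp add: sum_product peval_def mon_eval_def)
  finally show ?thesis .
qed

lemma peval_one [simp]: "peval 1 x = 1"
  unfolding single_one[symmetric] peval_single by (simp add: mon_eval_def)

lemma peval_prod: "peval (\<Prod>a\<in>A. f a) x = (\<Prod>a\<in>A. peval (f a) x)"
  by (induction A rule: infinite_finite_induct) (simp_all add: peval_mult)

lemma peval_pconst [simp]: "peval (pconst c) x = c"
  by (simp add: pconst_def peval_single mon_eval_def)

lemma peval_pvar [simp]: "peval (pvar i) x = x i"
  by (simp add: pvar_def peval_single mon_eval_def)

lemma peval_x_hat: "peval (x_hat \<Sigma> \<sigma>) x = (\<Prod>\<rho>\<in>fan_cones \<Sigma> 1 - cone_rays \<sigma>. x \<rho>)"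
  by (simp add: x_hat_def peval_prod)

section \<open>The polynomial ring in given variables and the irrelevant ideal\<close>

lemma poly_ring_zero: "0 \<in> poly_ring I"
  by (simp add: poly_ring_def)

lemma poly_ring_one: "1 \<in> poly_ring I"
  by (simp add: poly_ring_def)

lemma poly_ring_add: "p \<in> poly_ring I \<Longrightarrow> q \<in> poly_ring I \<Longrightarrow> p + q \<in> poly_ring I"
  using keys_add[of p q] by (auto simp: poly_ring_def)

lemma poly_ring_mult: "p \<in> poly_ring I \<Longrightarrow> q \<in> poly_ring I \<Longrightarrow> p * q \<in> poly_ring I"
  unfolding poly_ring_def using keys_mult[of p q] keys_add
  by (fastforce simp: subset_iff)

lemma poly_ring_pvar: "i \<in> I \<Longrightarrow> pvar i \<in> poly_ring I"
  by (simp add: poly_ring_def pvar_def)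

lemma poly_ring_x_hat: "x_hat \<Sigma> \<sigma> \<in> poly_ring (fan_cones \<Sigma> 1)"
proof -
  have "(\<Prod>\<rho>\<in>A. pvar \<rho>) \<in> poly_ring I" if "A \<subseteq> I" for A I :: "'a set set"
    using that by (induction A rule: infinite_finite_induct)
      (auto intro: poly_ring_one poly_ring_mult poly_ring_pvar)
  then show ?thesis
    by (simp add: x_hat_def)
qed

lemma poly_ideal_vanishing: "poly_ideal I {p \<in> poly_ring I. peval p x = 0}"
  by (auto simp: poly_ideal_def peval_add peval_mult poly_ring_zero
      intro: poly_ring_add poly_ring_mult)

text \<open>The polynomials vanishing at \<open>x\<close> form an ideal. If it contains the
  generators, it contains their hull, so no explicit description of the members of the ideal is
  required.\<close>

lemma irrelevant_ideal_vanishes: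
  assumes "\<And>\<sigma>. \<sigma> \<in> \<Sigma> \<Longrightarrow> peval (x_hat \<Sigma> \<sigma>) x = 0" and "p \<in> irrelevant_ideal \<Sigma>"
  shows "peval p x = 0"
proof -
  have "irrelevant_ideal \<Sigma> \<subseteq> {p \<in> poly_ring (fan_cones \<Sigma> 1). peval p x = 0}"
    unfolding irrelevant_ideal_def
    by (rule hull_minimal) (use assms(1) poly_ring_x_hat in \<open>auto intro: poly_ideal_vanishing\<close>)
  with assms(2) show ?thesis by blast
qed

section \<open>Projective points and their representatives\<close>

lemma proj_space_cases:
  assumes "X \<in> proj_space I" "x \<in> X"
  shows "X = proj_point I x" "x \<in> nonzero_vecs I"
proof -
  from assms(1) obtain z where z: "z \<in> nonzero_vecs I" "X = proj_rel I `` {z}"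
    by (auto simp: proj_space_def elim: quotientE)
  with assms(2) have zx: "(z, x) \<in> proj_rel I"
    by simp
  show "X = proj_point I x"
    using z(2) equiv_class_eq[OF equiv_proj_rel zx] by (simp add: proj_point_def)
  show "x \<in> nonzero_vecs I"
    using zx equiv_proj_rel by (metis equiv_class_eq_iff)
qed

lemma in_proj_point_iff:
  "y \<in> proj_point I x \<longleftrightarrow> x \<in> nonzero_vecs I \<and> (\<exists>c. c \<noteq> 0 \<and> y = (\<lambda>i. c * x i))"
  by (simp add: proj_point_def proj_rel_def)

lemma proj_point_scale:
  assumes "x \<in> nonzero_vecs I" "c \<noteq> 0"
  shows "proj_point I (\<lambda>i. c * x i) = proj_point I x"
proof -
  have "(x, \<lambda>i. c * x i) \<in> proj_rel I"
    using assms by (auto simp: proj_rel_def)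
  then show ?thesis
    unfolding proj_point_def by (metis equiv_class_eq[OF equiv_proj_rel])
qed

lemma proj_point_in_proj_space: "x \<in> nonzero_vecs I \<Longrightarrow> proj_point I x \<in> proj_space I"
  by (simp add: proj_point_def proj_space_def quotientI)


section \<open>Finitely generated cones and the rays of simplicial cones\<close>

lemma span_convex_cone_hull: "span (convex_cone hull S) = span S"
proof
  have "convex_cone hull S \<subseteq> span S"
    by (intro hull_minimal span_superset convex_cone_span)
  then show "span (convex_cone hull S) \<subseteq> span S"
    by (metis span_mono span_span)
  show "span S \<subseteq> span (convex_cone hull S)"
    by (intro span_mono hull_subset)
qed

text \<open>The nonnegative combinations of \<open>B\<close> form a convex cone containing
  \<open>B\<close>, hence they include the whole hull.\<close>

lemma convex_cone_hull_finite_cases: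
  assumes "finite B" "x \<in> convex_cone hull B"
  obtains c where "\<And>b. b \<in> B \<Longrightarrow> 0 \<le> c b" "x = (\<Sum>b\<in>B. c b *\<^sub>R b)"
proof -
  let ?K = "{x. \<exists>c. (\<forall>b\<in>B. 0 \<le> c b) \<and> x = (\<Sum>b\<in>B. c b *\<^sub>R b)}"
  have "convex_cone ?K"
    unfolding convex_cone_iff
  proof (intro conjI ballI allI impI)
    show "0 \<in> ?K"
      by (auto intro!: exI[of _ "\<lambda>_. 0"])
  next
    fix x y assume "x \<in> ?K" "y \<in> ?K"
    then obtain c e where "\<forall>b\<in>B. 0 \<le> c b" "x = (\<Sum>b\<in>B. c b *\<^sub>R b)"
      "\<forall>b\<in>B. 0 \<le> e b" "y = (\<Sum>b\<in>B. e b *\<^sub>R b)"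
      by blast
    then show "x + y \<in> ?K"
      by (auto intro!: exI[of _ "\<lambda>b. c b + e b"] simp: scaleR_add_left sum.distrib)
  next
    fix x and r :: real assume "x \<in> ?K" "0 \<le> r"
    then obtain c where "\<forall>b\<in>B. 0 \<le> c b" "x = (\<Sum>b\<in>B. c b *\<^sub>R b)"
      by blast
    with \<open>0 \<le> r\<close> show "r *\<^sub>R x \<in> ?K"
      by (auto intro!: exI[of _ "\<lambda>b. r * c b"] simp: scaleR_sum_right)
  qed
  moreover have "B \<subseteq> ?K"
  proof
    fix b assume "b \<in> B"
    then have "b = (\<Sum>b'\<in>B. (if b' = b then 1 else 0) *\<^sub>R b')"
      using assms(1) by (simp add: if_distrib[of "\<lambda>r. r *\<^sub>R _"] cong: if_cong)
    then show "b \<in> ?K"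
      by (intro CollectI exI[of _ "\<lambda>b'. if b' = b then 1 else 0"]) auto
  qed
  ultimately have "convex_cone hull B \<subseteq> ?K"
    by (rule hull_minimal[rotated])
  with assms(2) that show thesis
    by blast
qed

lemma convex_cone_hull_singleton: "convex_cone hull {b} = {t *\<^sub>R b | t. 0 \<le> t}"
proof (intro equalityI subsetI)
  fix x assume "x \<in> convex_cone hull {b}"
  then show "x \<in> {t *\<^sub>R b | t. 0 \<le> t}"
    by (rule convex_cone_hull_finite_cases[rotated]) auto
qed (auto intro: convex_cone_hull_mul hull_inc)

lemma convex_cone_hull_sum:
  assumes "\<And>b. b \<in> A \<Longrightarrow> 0 \<le> c b" "A \<subseteq> B"
  shows "(\<Sum>b\<in>A. c b *\<^sub>R b) \<in> convex_cone hull B"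
  using assms
  by (induction A rule: infinite_finite_induct)
    (auto intro: convex_cone_hull_add convex_cone_hull_mul hull_inc simp: convex_cone_hull_contains_0)

text \<open>A closed half-space through the origin is a convex cone, so it suffices to test the
  generators.\<close>

lemma linear_nonneg_on_convex_cone_hull:
  assumes "linear g" "\<And>b. b \<in> B \<Longrightarrow> (0::real) \<le> g b" "x \<in> convex_cone hull B"
  shows "0 \<le> g x"
proof -
  have "convex_cone {x. 0 \<le> g x}"
    by (auto simp: convex_cone_iff linear_0[OF assms(1)] linear_add[OF assms(1)]
        linear_scale[OF assms(1)])
  then have "convex_cone hull B \<subseteq> {x. 0 \<le> g x}"
    using assms(2) by (intro hull_minimal) auto
  with assms(3) show ?thesis by blast
qed

text \<open>Supporting hyperplanes cut out faces: at an interior point of a segment,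
  \<open>g\<close> is a combination with positive weights of two nonnegative values, and it vanishes
  only if both do.\<close>

lemma face_of_linear_zero:
  assumes "linear g" "convex C" "\<And>x. x \<in> C \<Longrightarrow> (0::real) \<le> g x"
  shows "{x \<in> C. g x = 0} face_of C"
proof -
  interpret linear g by fact
  have conv: "convex {x \<in> C. g x = 0}"
    using assms(2) by (auto simp: convex_def add scale)
  have "g a = 0 \<and> g b = 0"
    if "a \<in> C" "b \<in> C" "x \<in> open_segment a b" "g x = 0" for a b x
  proof -
    obtain t where t: "0 < t" "t < 1" "x = (1 - t) *\<^sub>R a + t *\<^sub>R b"
      using \<open>x \<in> open_segment a b\<close> by (auto simp: in_segment)
    then have "(1 - t) * g a + t * g b = 0"
      using \<open>g x = 0\<close> by (simp add: add scale)
    moreover have "0 \<le> (1 - t) * g a" "0 \<le> t * g b"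
      using t assms(3) that by auto
    ultimately have "(1 - t) * g a = 0" "t * g b = 0"
      by linarith+
    then show ?thesis using t by simp
  qed
  with conv show ?thesis
    by (auto simp: face_of_def)
qed

text \<open>Independence provides a linear functional that is 0 at \<open>b\<close> and 1 at every
  other generator. It is nonnegative on the cone, and its zero set there consists of the nonnegative
  multiples of \<open>b\<close>.\<close>

lemma ray_of_simplicial_cone:
  fixes B :: "'a::euclidean_space set"
  assumes "finite B" "independent B" "b \<in> B"
  shows "convex_cone hull {b} \<in> cone_rays (convex_cone hull B)"
proof -
  obtain g :: "'a \<Rightarrow> real" where g: "linear g" "\<forall>x\<in>B. g x = (if x = b then 0 else 1)"
    using linear_independent_extend[OF assms(2), of "\<lambda>x. if x = b then 0 else 1"] by blast
  have "convex_cone hull {b} = {x \<in> convex_cone hull B. g x = 0}"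
  proof (intro equalityI subsetI)
    fix x assume "x \<in> convex_cone hull {b}"
    then obtain t where "0 \<le> t" "x = t *\<^sub>R b"
      by (auto simp: convex_cone_hull_singleton)
    then show "x \<in> {x \<in> convex_cone hull B. g x = 0}"
      using assms(3) g by (auto intro: convex_cone_hull_mul hull_inc simp: linear_scale[OF g(1)])
  next
    fix x assume x: "x \<in> {x \<in> convex_cone hull B. g x = 0}"
    then obtain c where c: "\<And>b. b \<in> B \<Longrightarrow> 0 \<le> c b" "x = (\<Sum>b\<in>B. c b *\<^sub>R b)"
      using convex_cone_hull_finite_cases[OF assms(1)] by blast
    have "g x = (\<Sum>b'\<in>B. c b' * g b')"
      by (simp add: c(2) linear_sum[OF g(1)] linear_scale[OF g(1)])
    also have "\<dots> = (\<Sum>b'\<in>B - {b}. c b')"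
      by (subst sum.remove[OF assms(1,3)]) (use g assms(3) in auto)
    finally have "(\<Sum>b'\<in>B - {b}. c b') = 0"
      using x by simp
    then have "\<forall>b'\<in>B - {b}. c b' = 0"
      using c(1) assms(1) by (subst (asm) sum_nonneg_eq_0_iff) auto
    then have "x = c b *\<^sub>R b"
      unfolding c(2) by (subst sum.remove[OF assms(1,3)]) simp
    then show "x \<in> convex_cone hull {b}"
      using c(1) assms(3) by (auto simp: convex_cone_hull_singleton)
  qed
  moreover have "{x \<in> convex_cone hull B. g x = 0} face_of convex_cone hull B"
    by (rule face_of_linear_zero[OF g(1) convex_convex_cone_hull])
      (rule linear_nonneg_on_convex_cone_hull[OF g(1)], use g(2) in auto)
  moreover have "dim (convex_cone hull {b}) = 1"
  proof -
    have "b \<noteq> 0"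
      using assms(2,3) dependent_zero by blast
    then have "independent {b}"
      by simp
    then have "dim (span {b}) = card {b}"
      unfolding dim_span by (rule dim_eq_card_independent)
    then show ?thesis
      using span_convex_cone_hull[of "{b}"] dim_span[of "convex_cone hull {b}"] by simp
  qed
  ultimately show ?thesis
    by (simp add: cone_rays_def)
qed

text \<open>A one-dimensional face contains a positive multiple of some generator \<open>b\<close>.
  The face property and convexity extend this to the whole ray through \<open>b\<close>, and
  dimension one leaves room only for the line through \<open>b\<close>.\<close>

lemma cone_rays_simplicial:
  fixes B :: "'a::euclidean_space set"
  assumes "finite B" "independent B"
  shows "cone_rays (convex_cone hull B) = (\<lambda>b. convex_cone hull {b}) ` B"
proof (intro equalityI subsetI)
  fix F assume "F \<in> cone_rays (convex_cone hull B)"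
  then have F: "F face_of convex_cone hull B" and dimF: "dim F = 1"
    by (auto simp: cone_rays_def)
  have FC: "F \<subseteq> convex_cone hull B"
    using F by (rule face_of_imp_subset)
  obtain x where x: "x \<in> F" "x \<noteq> 0"
    using dimF dim_eq_0[of F] by auto
  text \<open>Peel off one generator \<open>b\<close> with positive coefficient: \<open>x = c\<^sub>b b + y\<close> is the midpoint of \<open>2 c\<^sub>b b\<close>
    and \<open>2 y\<close>, so the face \<open>F\<close> contains \<open>2 c\<^sub>b b\<close>.\<close>
  obtain c where c: "\<And>b. b \<in> B \<Longrightarrow> 0 \<le> c b" "x = (\<Sum>b\<in>B. c b *\<^sub>R b)"
    using convex_cone_hull_finite_cases[OF assms(1)] x(1) FC by blast
  obtain b where b: "b \<in> B" "c b \<noteq> 0"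
    using x(2) c(2) by (metis (no_types, lifting) scale_zero_left sum.neutral)
  then have cb: "0 < c b"
    using c(1)[of b] by simp
  have b0: "b \<noteq> 0"
    using assms(2) b(1) dependent_zero by blast
  have mult_b: "s *\<^sub>R b \<in> convex_cone hull B" if "0 \<le> s" for s
    using that b(1) by (intro convex_cone_hull_mul hull_inc)
  have "\<exists>t>0. t *\<^sub>R b \<in> F"
  proof (cases "x = (2 * c b) *\<^sub>R b")
    \<comment> \<open>Here the two endpoints \<open>2 c\<^sub>b b\<close> and \<open>2 y\<close>
      coincide and there is no open segment, but \<open>x\<close> itself is the required multiple of
      \<open>b\<close>.\<close>
    case True
    then show ?thesis
      using cb x(1) by (intro exI[of _ "2 * c b"]) simp
  next
    case False
    define y where "y = (\<Sum>b\<in>B - {b}. c b *\<^sub>R b)"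
    have xy: "x = c b *\<^sub>R b + y"
      unfolding c(2) y_def by (rule sum.remove[OF assms(1) b(1)])
    have "y \<in> convex_cone hull B"
      unfolding y_def by (rule convex_cone_hull_sum) (use c(1) in auto)
    then have y: "2 *\<^sub>R y \<in> convex_cone hull B"
      by (intro convex_cone_hull_mul) auto
    have "(2 * c b) *\<^sub>R b \<noteq> 2 *\<^sub>R y"
    proof
      assume "(2 * c b) *\<^sub>R b = 2 *\<^sub>R y"
      then have "2 *\<^sub>R (c b *\<^sub>R b) = 2 *\<^sub>R y"
        by simp
      then have "y = c b *\<^sub>R b"
        by (metis scaleR_left_imp_eq zero_neq_numeral)
      then show False
        using False xy by (simp add: scaleR_2 flip: scaleR_scaleR)
    qed
    then have "x \<in> open_segment ((2 * c b) *\<^sub>R b) (2 *\<^sub>R y)"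
      unfolding in_segment by (auto simp: xy intro!: exI[of _ "1/2"])
    then have "(2 * c b) *\<^sub>R b \<in> F"
      using face_ofD[OF F _ _ y x(1), of "(2 * c b) *\<^sub>R b"] mult_b[of "2 * c b"] cb by simp
    then show ?thesis
      using cb by (intro exI[of _ "2 * c b"]) simp
  qed
  then obtain t where t: "0 < t" "t *\<^sub>R b \<in> F"
    by blast
  \<comment> \<open>For \<open>m\<close> larger than \<open>t\<close>, the point \<open>t b\<close>
    lies strictly between 0 and \<open>m b\<close>, so the face contains both endpoints. Taking
    \<open>m\<close> larger than \<open>s\<close> as well puts \<open>s b\<close> between them, and
    convexity of \<open>F\<close> gives the claim.\<close>
  have ray: "s *\<^sub>R b \<in> F" if "0 \<le> s" for s
  proof -
    define m where "m = s + t + 1"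
    have m: "0 < m" "t < m" "s < m"
      using t that by (auto simp: m_def)
    have "t *\<^sub>R b \<in> open_segment 0 (m *\<^sub>R b)"
      using m t b0 unfolding in_segment by (auto intro!: exI[of _ "t / m"])
    then have "0 \<in> F" "m *\<^sub>R b \<in> F"
      using face_ofD[OF F _ convex_cone_hull_contains_0 mult_b[of m] t(2)] m by simp_all
    then have "(1 - s / m) *\<^sub>R 0 + (s / m) *\<^sub>R (m *\<^sub>R b) \<in> F"
      using face_of_imp_convex[OF F] m that by (intro convexD) auto
    then show ?thesis
      using m by simp
  qed
  have "F \<subseteq> convex_cone hull {b}"
  proof
    fix z assume z: "z \<in> F"
    have "b \<in> F"
      using ray[of 1] by simp
    then have "span {b} = span F"
      using b0 dimF by (intro dim_eq_span) auto
    then obtain k where k: "z = k *\<^sub>R b"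
      using z span_base[of z F] by (auto simp: span_singleton)
    \<comment> \<open>This functional reads off the coefficient of \<open>b\<close>. It is
      nonnegative on the cone, which excludes the opposite half of the line.\<close>
    obtain g :: "'a \<Rightarrow> real" where g: "linear g" "\<forall>x\<in>B. g x = (if x = b then 1 else 0)"
      using linear_independent_extend[OF assms(2), of "\<lambda>x. if x = b then 1 else 0"] by blast
    have "0 \<le> g z"
      by (rule linear_nonneg_on_convex_cone_hull[OF g(1), of B]) (use g(2) z FC in auto)
    then have "0 \<le> k"
      using g b(1) by (simp add: k linear_scale[OF g(1)])
    then show "z \<in> convex_cone hull {b}"
      using k by (auto simp: convex_cone_hull_singleton)
  qed
  moreover have "convex_cone hull {b} \<subseteq> F"
    using ray by (auto simp: convex_cone_hull_singleton)
  ultimately show "F \<in> (\<lambda>b. convex_cone hull {b}) ` B"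
    using b(1) by blast
qed (use ray_of_simplicial_cone[OF assms] in auto)

text \<open>Independent generators span pairwise distinct lines, so distinct generators give
  distinct rays; the number of generators is the dimension of their span.\<close>

lemma card_cone_rays:
  fixes \<sigma> :: "'a::euclidean_space set"
  assumes "simplicial_cone \<sigma>"
  shows "finite (cone_rays \<sigma>)" "card (cone_rays \<sigma>) = dim \<sigma>"
proof -
  obtain B where B: "finite B" "independent B" "\<sigma> = convex_cone hull B"
    using assms by (auto simp: simplicial_cone_def)
  have rays: "cone_rays \<sigma> = (\<lambda>b. convex_cone hull {b}) ` B"
    using cone_rays_simplicial B by simp
  then show "finite (cone_rays \<sigma>)"
    using B(1) by simp
  have "inj_on (\<lambda>b. convex_cone hull {b}) B"
  proof (rule inj_onI, rule ccontr)
    fix b b' assume b: "b \<in> B" "b' \<in> B" "convex_cone hull {b} = convex_cone hull {b'}" "b \<noteq> b'"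
    then have "span {b} = span {b'}"
      by (metis span_convex_cone_hull)
    then have "b \<in> span {b'}"
      using span_base[of b "{b}"] by simp
    then have "b \<in> span (B - {b})"
      using b span_mono[of "{b'}" "B - {b}"] by blast
    then show False
      using B(2) b(1) by (auto simp: dependent_def)
  qed
  then have "card (cone_rays \<sigma>) = card B"
    by (simp add: rays card_image)
  also have "\<dots> = dim \<sigma>"
    using dim_eq_card_independent[OF B(2)] dim_span[of B] dim_span[of \<sigma>]
      span_convex_cone_hull[of B] B(3) by simp
  finally show "card (cone_rays \<sigma>) = dim \<sigma>" .
qed

lemma cone_rays_mono:
  assumes "\<tau> face_of \<sigma>"
  shows "cone_rays \<tau> \<subseteq> cone_rays \<sigma>"
  using assms face_of_trans by (auto simp: cone_rays_def)

section \<open>The map \<open>phi\<close> and its relation to the matrix M\<close>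

context
  fixes \<Sigma> :: "(real^'d) set set"
  assumes simplicial: "simplicial_fan \<Sigma>"
begin

lemma finite_fan_cones: "finite (fan_cones \<Sigma> k)"
  using simplicial by (simp add: simplicial_fan_def polyhedral_fan_def fan_cones_def)

lemma cone_rays_subset: "\<sigma> \<in> \<Sigma> \<Longrightarrow> cone_rays \<sigma> \<subseteq> fan_cones \<Sigma> 1"
  using simplicial unfolding simplicial_fan_def polyhedral_fan_def fan_cones_def cone_rays_def
  by fastforce

lemma phi_vec_scale:
  "phi_vec \<Sigma> (\<lambda>\<rho>. c * x \<rho>) =
    (\<lambda>\<sigma>. c ^ (card (fan_cones \<Sigma> 1) - CARD('d)) * phi_vec \<Sigma> x \<sigma>)"
proof
  fix \<sigma>
  show "phi_vec \<Sigma> (\<lambda>\<rho>. c * x \<rho>) \<sigma> =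
      c ^ (card (fan_cones \<Sigma> 1) - CARD('d)) * phi_vec \<Sigma> x \<sigma>"
  proof (cases "\<sigma> \<in> fan_cones \<Sigma> CARD('d)")
    case True
    then have \<sigma>: "\<sigma> \<in> \<Sigma>" "dim \<sigma> = CARD('d)"
      by (auto simp: fan_cones_def)
    then have "simplicial_cone \<sigma>"
      using simplicial by (simp add: simplicial_fan_def)
    \<comment> \<open>The d rays of \<sigma> all belong to \<Sigma>(1), so the subtraction of
      natural numbers is not truncated.\<close>
    then have "card (fan_cones \<Sigma> 1 - cone_rays \<sigma>) = card (fan_cones \<Sigma> 1) - CARD('d)"
      using card_Diff_subset[OF _ cone_rays_subset[OF \<sigma>(1)]] card_cone_rays[of \<sigma>] \<sigma>(2)
      by simp
    then show ?thesis
      using True by (simp add: phi_vec_def peval_x_hat prod.distrib)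
  qed (simp add: phi_vec_def)
qed

text \<open>Changing the representative multiplies \<open>phi_vec\<close> by a nonzero power of the
  scalar, so the set passed to \<open>the_elem\<close> is a singleton. Nonvanishing matters since
  \<open>proj_point\<close> of the zero vector is the empty set.\<close>

lemma phi_proj_point:
  assumes "X \<in> proj_space (fan_cones \<Sigma> 1)" "x \<in> X"
    and "phi_vec \<Sigma> x \<in> nonzero_vecs (fan_cones \<Sigma> CARD('d))"
  shows "phi \<Sigma> X = proj_point (fan_cones \<Sigma> CARD('d)) (phi_vec \<Sigma> x)"
proof -
  have "proj_point (fan_cones \<Sigma> CARD('d)) (phi_vec \<Sigma> z) =
      proj_point (fan_cones \<Sigma> CARD('d)) (phi_vec \<Sigma> x)" if "z \<in> X" for z
  proof -
    have "z \<in> proj_point (fan_cones \<Sigma> 1) x"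
      using that proj_space_cases(1)[OF assms(1,2)] by blast
    then obtain c where "c \<noteq> 0" "z = (\<lambda>i. c * x i)"
      by (auto simp: in_proj_point_iff)
    then show ?thesis
      using assms(3) by (simp add: phi_vec_scale proj_point_scale)
  qed
  then have "(\<lambda>z. proj_point (fan_cones \<Sigma> CARD('d)) (phi_vec \<Sigma> z)) ` X =
      {proj_point (fan_cones \<Sigma> CARD('d)) (phi_vec \<Sigma> x)}"
    using assms(2) by blast
  then show ?thesis
    by (simp add: phi_def)
qed

lemma phi_in_Y_variety:
  assumes "X \<in> proj_space (fan_cones \<Sigma> 1)" "X \<notin> irrelevant_locus \<Sigma>"
  shows "phi \<Sigma> X \<in> Y_variety \<Sigma>"
  unfolding Y_variety_def using assms by (intro hull_inc imageI) simp

text \<open>Some generator \<open>x_hat \<Sigma> \<tau>\<close> is nonzero at a representative.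
  Purity makes \<tau> a face of a d-dimensional cone, whose monomial is then nonzero at the same
  representative.\<close>

lemma phi_vec_nonzero_outside_irrelevant_locus:
  assumes "\<Sigma> = pure_subfan \<Sigma>"
    and "X \<in> proj_space (fan_cones \<Sigma> 1)" "X \<notin> irrelevant_locus \<Sigma>"
  obtains x where "x \<in> X" "phi_vec \<Sigma> x \<in> nonzero_vecs (fan_cones \<Sigma> CARD('d))"
proof -
  obtain x p where x: "x \<in> X" and "p \<in> irrelevant_ideal \<Sigma>" "peval p x \<noteq> 0"
    using assms(2,3) by (auto simp: irrelevant_locus_def proj_zeros_def)
  then obtain \<tau> where \<tau>: "\<tau> \<in> \<Sigma>" "peval (x_hat \<Sigma> \<tau>) x \<noteq> 0"
    using irrelevant_ideal_vanishes[of \<Sigma> x p] by blast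
  obtain \<sigma> where \<sigma>: "\<sigma> \<in> fan_cones \<Sigma> CARD('d)" "\<tau> face_of \<sigma>"
    using \<tau>(1) assms(1) unfolding pure_subfan_def by auto
  \<comment> \<open>Since \<tau>(1) is contained in \<sigma>(1), every factor of the monomial of
    \<sigma> is also a factor of the monomial of \<tau>.\<close>
  have "peval (x_hat \<Sigma> \<sigma>) x \<noteq> 0"
    using \<tau>(2) cone_rays_mono[OF \<sigma>(2)] finite_fan_cones[of 1] by (auto simp: peval_x_hat)
  then have "phi_vec \<Sigma> x \<sigma> \<noteq> 0"
    using \<sigma>(1) by (simp add: phi_vec_def)
  moreover have "phi_vec \<Sigma> x \<tau>' = 0" if "\<tau>' \<notin> fan_cones \<Sigma> CARD('d)" for \<tau>'
    using that by (simp add: phi_vec_def)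
  ultimately have "phi_vec \<Sigma> x \<in> nonzero_vecs (fan_cones \<Sigma> CARD('d))"
    unfolding nonzero_vecs_def by blast
  with x that show thesis by blast
qed

lemma M_matrix_phi_vec:
  assumes "\<rho> \<in> fan_cones \<Sigma> 1"
  shows "(\<Sum>\<sigma>\<in>fan_cones \<Sigma> CARD('d). complex_of_real (M_matrix u \<rho> \<sigma>) * phi_vec \<Sigma> x \<sigma>) =
    x \<rho> * deriv (\<lambda>t. peval (Adj \<Sigma> u) (x(\<rho> := t))) (x \<rho>)"
proof -
  let ?R = "\<lambda>\<sigma>. fan_cones \<Sigma> 1 - cone_rays \<sigma>"
  \<comment> \<open>As a function of the coordinate at \<rho>, each monomial is affine:
    \<open>D\<close> is its slope and \<open>E\<close> its constant term.\<close>
  define D where "D \<sigma> = (if \<rho> \<in> cone_rays \<sigma> then 0 else \<Prod>\<rho>'\<in>?R \<sigma> - {\<rho>}. x \<rho>')" for \<sigma>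
  define E where "E \<sigma> = (if \<rho> \<in> cone_rays \<sigma> then \<Prod>\<rho>'\<in>?R \<sigma>. x \<rho>' else 0)" for \<sigma>
  have affine: "(\<Prod>\<rho>'\<in>?R \<sigma>. (x(\<rho> := t)) \<rho>') = t * D \<sigma> + E \<sigma>" for \<sigma> t
  proof (cases "\<rho> \<in> cone_rays \<sigma>")
    case True
    then show ?thesis
      by (auto simp: D_def E_def intro!: prod.cong)
  next
    case False
    then have "(\<Prod>\<rho>'\<in>?R \<sigma>. (x(\<rho> := t)) \<rho>') = t * (\<Prod>\<rho>'\<in>?R \<sigma> - {\<rho>}. (x(\<rho> := t)) \<rho>')"
      using assms finite_fan_cones[of 1] by (subst prod.remove[of _ \<rho>]) auto
    also have "(\<Prod>\<rho>'\<in>?R \<sigma> - {\<rho>}. (x(\<rho> := t)) \<rho>') = D \<sigma>"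
      using False by (auto simp: D_def intro!: prod.cong)
    finally show ?thesis
      using False by (simp add: E_def)
  qed
  have "((\<lambda>t. \<Sum>\<sigma>\<in>fan_cones \<Sigma> CARD('d).
        complex_of_real (abs_det_cone u \<sigma>) * (t * D \<sigma> + E \<sigma>))
      has_field_derivative
        (\<Sum>\<sigma>\<in>fan_cones \<Sigma> CARD('d). complex_of_real (abs_det_cone u \<sigma>) * D \<sigma>)) (at (x \<rho>))"
    by (auto intro!: derivative_eq_intros simp: mult.commute)
  moreover have "peval (Adj \<Sigma> u) (x(\<rho> := t)) = (\<Sum>\<sigma>\<in>fan_cones \<Sigma> CARD('d).
        complex_of_real (abs_det_cone u \<sigma>) * (t * D \<sigma> + E \<sigma>))" for t
    unfolding Adj_def peval_sum peval_mult peval_x_hat peval_pconst affine ..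
  ultimately have "deriv (\<lambda>t. peval (Adj \<Sigma> u) (x(\<rho> := t))) (x \<rho>) =
      (\<Sum>\<sigma>\<in>fan_cones \<Sigma> CARD('d). complex_of_real (abs_det_cone u \<sigma>) * D \<sigma>)"
    by (simp add: DERIV_imp_deriv)
  moreover have "complex_of_real (M_matrix u \<rho> \<sigma>) * phi_vec \<Sigma> x \<sigma> =
      x \<rho> * (complex_of_real (abs_det_cone u \<sigma>) * D \<sigma>)"
    if "\<sigma> \<in> fan_cones \<Sigma> CARD('d)" for \<sigma>
  proof (cases "\<rho> \<in> cone_rays \<sigma>")
    case True
    then show ?thesis
      by (simp add: M_matrix_def D_def)
  next
    case False
    then have "E \<sigma> = 0"
      by (simp add: E_def)
    \<comment> \<open>Taking \<open>t = x \<rho>\<close> in \<open>affine\<close> leaves the vector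
      \<open>x\<close> unchanged, so the affine form returns the monomial at
      \<open>x\<close>.\<close>
    then have "phi_vec \<Sigma> x \<sigma> = x \<rho> * D \<sigma>"
      using that affine[of "x \<rho>" \<sigma>] by (simp add: phi_vec_def peval_x_hat)
    with False show ?thesis
      by (simp add: M_matrix_def)
  qed
  ultimately show ?thesis
    by (simp add: sum_distrib_left)
qed

end

theorem corollary7p9:
  fixes \<Sigma> :: "(real^'d) set set" and u :: "(real^'d) set \<Rightarrow> real^'d"
  assumes "simplicial_fan \<Sigma>"
    and "ray_matrix \<Sigma> u"
    and "\<Sigma> = pure_subfan \<Sigma>"
    and "{y \<in> Y_variety \<Sigma>. y \<in> M_kernel \<Sigma> u} = {}"
  shows "Sing \<Sigma> u \<subseteq> irrelevant_locus \<Sigma>"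
proof (rule subsetI, rule ccontr)
  let ?J = "fan_cones \<Sigma> CARD('d)"
  fix X assume "X \<in> Sing \<Sigma> u" and X_notin: "X \<notin> irrelevant_locus \<Sigma>"
  then have X: "X \<in> proj_space (fan_cones \<Sigma> 1)"
    and sing: "\<And>x \<rho>. x \<in> X \<Longrightarrow> \<rho> \<in> fan_cones \<Sigma> 1 \<Longrightarrow>
      deriv (\<lambda>t. peval (Adj \<Sigma> u) (x(\<rho> := t))) (x \<rho>) = 0"
    by (auto simp: Sing_def)
  obtain x where x: "x \<in> X" and nz: "phi_vec \<Sigma> x \<in> nonzero_vecs ?J"
    using phi_vec_nonzero_outside_irrelevant_locus[OF assms(1,3) X X_notin] .
  have kernel: "(\<Sum>\<sigma>\<in>?J. complex_of_real (M_matrix u \<rho> \<sigma>) * phi_vec \<Sigma> x \<sigma>) = 0"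
    if "\<rho> \<in> fan_cones \<Sigma> 1" for \<rho>
    using M_matrix_phi_vec[OF assms(1) that, of u x] sing[OF x that] by simp
  \<comment> \<open>Membership in \<open>M_kernel\<close> concerns all representatives. They are
    scalar multiples of \<open>phi_vec \<Sigma> x\<close>, so linearity of the equations reduces the
    claim to \<open>kernel\<close>.\<close>
  have "proj_point ?J (phi_vec \<Sigma> x) \<in> M_kernel \<Sigma> u"
    unfolding M_kernel_def
  proof (intro CollectI conjI ballI)
    show "proj_point ?J (phi_vec \<Sigma> x) \<in> proj_space ?J"
      using nz by (rule proj_point_in_proj_space)
  next
    fix y \<rho> assume "y \<in> proj_point ?J (phi_vec \<Sigma> x)" and \<rho>: "\<rho> \<in> fan_cones \<Sigma> 1"
    then obtain c where "y = (\<lambda>\<sigma>. c * phi_vec \<Sigma> x \<sigma>)"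
      by (auto simp: in_proj_point_iff)
    then have "(\<Sum>\<sigma>\<in>?J. complex_of_real (M_matrix u \<rho> \<sigma>) * y \<sigma>) =
        c * (\<Sum>\<sigma>\<in>?J. complex_of_real (M_matrix u \<rho> \<sigma>) * phi_vec \<Sigma> x \<sigma>)"
      by (simp add: sum_distrib_left mult_ac)
    then show "(\<Sum>\<sigma>\<in>?J. complex_of_real (M_matrix u \<rho> \<sigma>) * y \<sigma>) = 0"
      using kernel[OF \<rho>] by simp
  qed
  moreover have "proj_point ?J (phi_vec \<Sigma> x) \<in> Y_variety \<Sigma>"
    using phi_in_Y_variety[OF assms(1) X X_notin] phi_proj_point[OF assms(1) X x nz] by simp
  ultimately show False
    using assms(4) by blast
qed

end
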